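(* Let $G$ be a connected weighted undirected graph with vertex set $V$ and modularity matrix $M$. Let $S_1,\ldots,S_k$ be pairwise disjoint subsets of $V$, with $k\ge 1$, such that for every $i=1,\dots,k$ one has $\mathrm{vol}(S_i)\le\frac12\mathrm{vol}\,G$ and $e_{\mathrm{in}}(S_i)>e_{\mathrm{out}}(S_i)$. Then $Q(S_i)>0$ for every $i=1,\dots,k$, and $M$ has at least $k-1$ positive eigenvalues (counted with multiplicity).
   Context: A graph $G=(V,E,\omega)$, $V=\{1,\dots,n\}$, is finite, undirected, connected, without multiple edges (loops are allowed), with edge weights $\omega:E\to\mathbb{R}^+$. Its adjacency matrix $A=(a_{ij})$ is the symmetric matrix with $a_{ij}=\omega(ij)>0$ if $ij\in E$ and $a_{ij}=0$ otherwise. The degree is $d_i=\sum_j a_{ij}$, $d=(d_1,\dots,d_n)^T$. For $S\subseteq V$, $\mathrm{vol}\,S=\sum_{i\in S}d_i$ and $\mathrm{vol}\,G=\mathrm{vol}\,V$; $\bar S=V\setminus S$; $\mathbf 1_S\in\{0,1\}^n$ is the characteristic vector of $S$. For $S,T\subseteq V$, $e(S,T)=\mathbf 1_S^TA\mathbf 1_T=\sum_{i\in S}\sum_{j\in T}a_{ij}$; $e_{\mathrm{in}}(S)=e(S,S)$ (so each non-loop internal edge is counted twice) and $e_{\mathrm{out}}(S)=e(S,\bar S)$. The modularity matrix is $M=A-\frac{1}{\mathrm{vol}\,G}dd^T$, and the modularity of $S$ is $Q(S)=e_{\mathrm{in}}(S)-(\mathrm{vol}\,S)^2/\mathrm{vol}\,G=\mathbf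 1_S^TM\mathbf 1_S$. *)

theory Defs
  imports "Jordan_Normal_Form.Char_Poly" "HOL-Library.Disjoint_Sets" "HOL-Library.Indicator_Function"
begin

(* The vertex set is {..<n}, matching the 0-based indices of the matrices.  An edge is the set
   of its endpoints, so edges are undirected and simple, and a singleton edge is a loop. *)
locale connected_weighted_graph =
  fixes n :: nat and E :: "nat set set" and \<omega> :: "nat set \<Rightarrow> real"
  assumes nonempty: "n \<ge> 1"
    and edge_ends: "\<And>e. e \<in> E \<Longrightarrow> \<exists>u<n. \<exists>v<n. e = {u, v}"
    and weight_pos: "\<And>e. e \<in> E \<Longrightarrow> \<omega> e > 0"
    and connected: "\<And>u v. u < n \<Longrightarrow> v < n \<Longrightarrow> (u, v) \<in> {(x, y). {x, y} \<in> E}\<^sup>*"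

definition adj_mat :: "nat \<Rightarrow> nat set set \<Rightarrow> (nat set \<Rightarrow> real) \<Rightarrow> real mat" where
  "adj_mat n E \<omega> = mat n n (\<lambda>(i, j). if {i, j} \<in> E then \<omega> {i, j} else 0)"

definition deg_vec :: "nat \<Rightarrow> nat set set \<Rightarrow> (nat set \<Rightarrow> real) \<Rightarrow> real vec" where
  "deg_vec n E \<omega> = vec n (\<lambda>i. \<Sum>j<n. adj_mat n E \<omega> $$ (i, j))"

definition vol :: "nat \<Rightarrow> nat set set \<Rightarrow> (nat set \<Rightarrow> real) \<Rightarrow> nat set \<Rightarrow> real" where
  "vol n E \<omega> S = (\<Sum>i\<in>S. deg_vec n E \<omega> $ i)"

definition e_between ::
    "nat \<Rightarrow> nat set set \<Rightarrow> (nat set \<Rightarrow> real) \<Rightarrow> nat set \<Rightarrow> nat set \<Rightarrow> real" where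
  "e_between n E \<omega> S T = (\<Sum>i\<in>S. \<Sum>j\<in>T. adj_mat n E \<omega> $$ (i, j))"

definition e_in :: "nat \<Rightarrow> nat set set \<Rightarrow> (nat set \<Rightarrow> real) \<Rightarrow> nat set \<Rightarrow> real" where
  "e_in n E \<omega> S = e_between n E \<omega> S S"

definition e_out :: "nat \<Rightarrow> nat set set \<Rightarrow> (nat set \<Rightarrow> real) \<Rightarrow> nat set \<Rightarrow> real" where
  "e_out n E \<omega> S = e_between n E \<omega> S ({..<n} - S)"

definition modularity_mat :: "nat \<Rightarrow> nat set set \<Rightarrow> (nat set \<Rightarrow> real) \<Rightarrow> real mat" where
  "modularity_mat n E \<omega> = adj_mat n E \<omega> -
     (1 / vol n E \<omega> {..<n}) \<cdot>\<^sub>m mat n n (\<lambda>(i, j). deg_vec n E \<omega> $ i * deg_vec n E \<omega> $ j)"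

definition modularity :: "nat \<Rightarrow> nat set set \<Rightarrow> (nat set \<Rightarrow> real) \<Rightarrow> nat set \<Rightarrow> real" where
  "modularity n E \<omega> S = e_in n E \<omega> S - (vol n E \<omega> S)\<^sup>2 / vol n E \<omega> {..<n}"

lemma modularity_quadratic_form:
  assumes "S \<subseteq> {..<n}"
  shows "modularity n E \<omega> S =
    vec n (indicator S) \<bullet> (modularity_mat n E \<omega> *\<^sub>v vec n (indicator S))"
proof -
  let ?D = "deg_vec n E \<omega>" and ?V = "vol n E \<omega> {..<n}" and ?A = "adj_mat n E \<omega>"
  have M: "modularity_mat n E \<omega> $$ (i, j) = ?A $$ (i, j) - ?D $ i * ?D $ j / ?V"
    if "i < n" "j < n" for i j
    using that by (simp add: modularity_mat_def adj_mat_def)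
  have dim: "dim_row (modularity_mat n E \<omega>) = n" "dim_col (modularity_mat n E \<omega>) = n"
    by (simp_all add: modularity_mat_def)
  have ind: "(\<Sum>i<n. indicator S i * f i) = sum f S" for f :: "nat \<Rightarrow> real"
    using assms sum.inter_restrict[of "{..<n}" f S]
    by (simp add: indicator_def if_distrib[of "\<lambda>x. x * _"] Int_absorb1 cong: if_cong)
  have "vec n (indicator S) \<bullet> (modularity_mat n E \<omega> *\<^sub>v vec n (indicator S)) =
      (\<Sum>i<n. indicator S i * (\<Sum>j<n. indicator S j * (?A $$ (i, j) - ?D $ i * ?D $ j / ?V)))"
    by (auto simp: scalar_prod_def dim M lessThan_atLeast0 mult.commute intro!: sum.cong)
  also have "\<dots> = (\<Sum>i\<in>S. \<Sum>j\<in>S. ?A $$ (i, j) - ?D $ i * ?D $ j / ?V)"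
    by (simp only: ind)
  also have "\<dots> = modularity n E \<omega> S"
    by (simp add: modularity_def e_in_def e_between_def vol_def sum_subtractf power2_eq_square
        sum_product sum_divide_distrib)
  finally show ?thesis ..
qed

definition num_pos_eigenvalues :: "real mat \<Rightarrow> nat" where
  "num_pos_eigenvalues B = (\<Sum>x | eigenvalue B x \<and> x > 0. order x (char_poly B))"

end

theory Submission
  imports Defs "Jordan_Normal_Form.Schur_Decomposition" "Jordan_Normal_Form.Spectral_Radius"
begin

text \<open>
  Positivity of each modularity is elementary: \<open>vol S = e_in S + e_out S < 2 * e_in S\<close>, while
  \<open>(vol S)\<^sup>2 / vol G \<le> vol S / 2\<close> since \<open>S\<close> has at most half of the total volume.

  For the eigenvalues, consider vectors \<open>x = (\<Sum>a. c\<^sub>a 1\<^bsub>S a\<^esub>)\<close>. On them the quadratic form of the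
  adjacency matrix is that of the \<open>k \<times> k\<close> matrix \<open>e(S a, S b)\<close>, evaluated at \<open>c\<close>. The sets
  being disjoint, the off-diagonal entries in row \<open>a\<close> sum up to at most \<open>e_out (S a)\<close>, which is
  less than the diagonal entry \<open>e_in (S a)\<close>. This matrix is thus strictly diagonally dominant, hence
  positive definite (\<open>strictly_diagonally_dominant_pos\<close>). The modularity matrix differs from the
  adjacency matrix by a multiple of \<open>d d\<^sup>T\<close>, which vanishes on vectors orthogonal to \<open>d\<close>; so its
  form is positive on a space of dimension at least \<open>k - 1\<close>.

  A symmetric matrix whose form is positive on a space of that dimension has as many positive
  eigenvalues (\<open>num_pos_eigenvalues_ge_dim\<close>). This rests on the spectral theorem
  (\<open>real_symmetric_diagonalization\<close>) and a count of linear equations: with fewer positive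
  eigenvalues some nonzero vector of the space would have vanishing coordinates along all their
  eigenvectors, and the form could not be positive there.
\<close>

section \<open>Orthogonal diagonalisation of real symmetric matrices\<close>

text \<open>
  For an eigenvector \<open>v\<close>, moving the symmetric matrix across the Hermitian product
  \<open>(A v) \<bullet>c v\<close> shows that the eigenvalue equals its own conjugate.
\<close>

lemma symmetric_eigenvalue_real:
  fixes A :: "real mat"
  assumes A: "A \<in> carrier_mat n n" and sym: "A\<^sup>T = A"
    and l: "eigenvalue (map_mat complex_of_real A) l"
  shows "l \<in> \<real>"
proof -
  let ?C = "map_mat complex_of_real A"
  have C: "?C \<in> carrier_mat n n" using A by simp
  obtain v where v: "v \<in> carrier_vec n" "v \<noteq> 0\<^sub>v n" "?C *\<^sub>v v = l \<cdot>\<^sub>v v"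
    using l A unfolding eigenvalue_def eigenvector_def by auto
  have cv: "conjugate v \<in> carrier_vec n" using v by simp
  have Csym: "?C\<^sup>T = ?C" using sym by (metis map_mat_transpose)
  have conjC: "?C *\<^sub>v conjugate v = conjugate (?C *\<^sub>v v)"
    using A v(1) by (intro eq_vecI) (auto simp: scalar_prod_def)
  have "l * (v \<bullet>c v) = (?C *\<^sub>v v) \<bullet> conjugate v"
    using v cv by simp
  also have "\<dots> = v \<bullet> (?C *\<^sub>v conjugate v)"
    using transpose_vec_mult_scalar[OF C cv v(1)] Csym by simp
  also have "\<dots> = cnj l * (v \<bullet>c v)"
    unfolding conjC v(3) using v cv by (simp add: conjugate_smult_vec)
  finally have "l = cnj l"
    using v conjugate_square_eq_0_vec[OF v(1)] by auto
  then show ?thesis by (simp add: complex_is_Real_iff complex_eq_iff)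
qed

text \<open>
  The fundamental theorem of algebra provides a complex eigenvalue. It is real, and so it is
  already a root of the real characteristic polynomial.
\<close>

lemma symmetric_has_eigenvalue:
  fixes A :: "real mat"
  assumes A: "A \<in> carrier_mat n n" and sym: "A\<^sup>T = A" and n: "n > 0"
  shows "\<exists>e. eigenvalue A e"
proof -
  let ?C = "map_mat complex_of_real A"
  have C: "?C \<in> carrier_mat n n" using A by simp
  obtain l where l: "eigenvalue ?C l"
    using spectrum_non_empty[OF C n] by (auto simp: spectrum_def)
  obtain r where r: "l = complex_of_real r"
    using symmetric_eigenvalue_real[OF A sym l] by (auto elim: Reals_cases)
  have "poly (map_poly complex_of_real (char_poly A)) (complex_of_real r) = 0"
    using l unfolding eigenvalue_root_char_poly[OF C] of_real_hom.char_poly_hom[OF A] r .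
  then have "poly (char_poly A) r = 0" by simp
  then show ?thesis using eigenvalue_root_char_poly[OF A] by auto
qed

text \<open>
  Completing \<open>v\<close> to a basis and applying Gram--Schmidt keeps \<open>v\<close> as first vector; it
  remains to normalise the resulting orthogonal vectors.
\<close>

lemma orthogonal_mat_with_first_col:
  fixes v :: "real vec"
  assumes v: "v \<in> carrier_vec n" "v \<noteq> 0\<^sub>v n"
  shows "\<exists>W c. W \<in> carrier_mat n n \<and> W\<^sup>T * W = 1\<^sub>m n \<and> col W 0 = c \<cdot>\<^sub>v v"
proof -
  interpret cof_vec_space n "TYPE(real)" .
  define b where "b = basis_completion v"
  from basis_completion[OF v, folded b_def]
  have b: "set b \<subseteq> carrier_vec n" "distinct b" "\<not> lin_dep (set b)"
    and hdb: "hd b = v" and len_b: "length b = n"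
    by auto
  have n: "n > 0" using v by (cases n) auto
  then obtain vs where bv: "b = v # vs" using hdb len_b by (cases b) auto
  define ws where "ws = gram_schmidt n b"
  from gram_schmidt_result[OF b refl, folded ws_def]
  have ws: "set ws \<subseteq> carrier_vec n" "corthogonal ws" "length ws = n"
    by (auto simp: len_b)
  have hdws: "ws ! 0 = v"
    using gram_schmidt_hd[OF v(1), of vs, folded bv ws_def] ws(3) n
    by (metis hd_conv_nth length_greater_0_conv)
  define r where "r i = 1 / sqrt (ws ! i \<bullet> ws ! i)" for i
  define W where "W = mat n n (\<lambda>(i, j). r j * ws ! j $ i)"
  have wsc: "ws ! i \<in> carrier_vec n" if "i < n" for i using ws that by auto
  have W: "W \<in> carrier_mat n n" by (simp add: W_def)
  have colW: "col W j = r j \<cdot>\<^sub>v ws ! j" if "j < n" for j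
    using that wsc[OF that] by (intro eq_vecI) (auto simp: W_def)
  have orth: "ws ! i \<bullet> ws ! j = 0 \<longleftrightarrow> i \<noteq> j" if "i < n" "j < n" for i j
    using corthogonalD[OF ws(2)] that ws(3) by simp
  have "W\<^sup>T * W = 1\<^sub>m n"
  proof (rule eq_matI)
    fix i j assume "i < dim_row (1\<^sub>m n :: real mat)" "j < dim_col (1\<^sub>m n :: real mat)"
    then have ij: "i < n" "j < n" by auto
    have "(W\<^sup>T * W) $$ (i, j) = col W i \<bullet> col W j" using ij W by simp
    also have "\<dots> = r i * r j * (ws ! i \<bullet> ws ! j)"
      using ij wsc[OF ij(1)] wsc[OF ij(2)] by (simp add: colW)
    also have "\<dots> = (1\<^sub>m n) $$ (i, j)"
    proof (cases "i = j")
      case True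
      have "ws ! i \<bullet> ws ! i \<ge> 0" by (simp add: scalar_prod_def sum_nonneg)
      then have "ws ! i \<bullet> ws ! i > 0" using orth[OF ij(1) ij(1)] by auto
      then show ?thesis using ij True by (simp add: r_def)
    qed (use orth ij in auto)
    finally show "(W\<^sup>T * W) $$ (i, j) = (1\<^sub>m n) $$ (i, j)" .
  qed (use W in auto)
  then show ?thesis using W colW[OF n] hdws by auto
qed

text \<open>
  The spectral theorem for real symmetric matrices, by deflation: conjugating with an orthogonal
  matrix whose first column is an eigenvector makes the first column a multiple of the first unit
  vector. Conjugation by an orthogonal matrix preserves symmetry, so the first row vanishes off the
  diagonal as well, and the remaining block is a smaller symmetric matrix.
\<close>

theorem real_symmetric_diagonalization:
  fixes A :: "real mat"
  assumes "A \<in> carrier_mat n n" "A\<^sup>T = A"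
  shows "\<exists>P f. P \<in> carrier_mat n n \<and> P\<^sup>T * P = 1\<^sub>m n \<and> P\<^sup>T * A * P = mat_diag n f"
  using assms
proof (induction n arbitrary: A)
  case 0
  then show ?case
    by (intro exI[of _ "1\<^sub>m 0"] exI[of _ "\<lambda>_. 0"] conjI eq_matI) (auto simp: mat_diag_def)
next
  case (Suc m A)
  let ?n = "Suc m"
  note A = Suc.prems(1) and sym = Suc.prems(2)
  obtain e v where v: "v \<in> carrier_vec ?n" "v \<noteq> 0\<^sub>v ?n" "A *\<^sub>v v = e \<cdot>\<^sub>v v"
    using symmetric_has_eigenvalue[OF A sym] A unfolding eigenvalue_def eigenvector_def by auto
  obtain W c where W: "W \<in> carrier_mat ?n ?n" "W\<^sup>T * W = 1\<^sub>m ?n" "col W 0 = c \<cdot>\<^sub>v v"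
    using orthogonal_mat_with_first_col[OF v(1,2)] by blast
  define A' where "A' = W\<^sup>T * A * W"
  have WT: "W\<^sup>T \<in> carrier_mat ?n ?n" using W by simp
  have A': "A' \<in> carrier_mat ?n ?n" using A W by (simp add: A'_def)
  have A'sym: "A'\<^sup>T = A'"
    unfolding A'_def using A W WT sym by (simp add: transpose_mult[of _ ?n ?n _ ?n])
  have A'ij: "A' $$ (i, j) = A' $$ (j, i)" if "i < ?n" "j < ?n" for i j
    using arg_cong[OF A'sym, of "\<lambda>B. B $$ (i, j)"] A' that by simp
  have A'0: "A' $$ (i, 0) = (if i = 0 then e else 0)" if i: "i < ?n" for i
  proof -
    have "A *\<^sub>v col W 0 = e \<cdot>\<^sub>v col W 0"
      unfolding W(3) using v A by (simp add: mult_mat_vec[of _ ?n ?n] smult_smult_assoc mult.commute)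
    moreover have "A' $$ (i, 0) = col W i \<bullet> (A *\<^sub>v col W 0)"
    proof -
      have "A' = W\<^sup>T * (A * W)" unfolding A'_def using A W WT by simp
      then have "A' $$ (i, 0) = col W i \<bullet> col (A * W) 0"
        using i W(1) by simp
      also have "col (A * W) 0 = A *\<^sub>v col W 0" using A W(1) by (rule col_mult2) simp
      finally show ?thesis .
    qed
    moreover have "col W i \<bullet> col W 0 = (1\<^sub>m ?n) $$ (i, 0)"
      unfolding W(2)[symmetric] using i W(1) by simp
    ultimately show ?thesis using i W(1) by simp
  qed
  define A3 where "A3 = mat m m (\<lambda>(i, j). A' $$ (Suc i, Suc j))"
  have A3: "A3 \<in> carrier_mat m m" by (simp add: A3_def)
  have "A3\<^sup>T = A3" using A'ij by (intro eq_matI) (auto simp: A3_def)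
  from Suc.IH[OF A3 this] obtain P f where
    P: "P \<in> carrier_mat m m" "P\<^sup>T * P = 1\<^sub>m m" "P\<^sup>T * A3 * P = mat_diag m f" by blast
  let ?Z = "0\<^sub>m 1 m :: real mat" and ?Z' = "0\<^sub>m m 1 :: real mat"
  let ?e = "mat 1 1 (\<lambda>_. e)"
  define B where "B = four_block_mat (1\<^sub>m 1) ?Z ?Z' P"
  have A'block: "A' = four_block_mat ?e ?Z ?Z' A3"
  proof (rule eq_matI)
    fix i j assume "i < dim_row (four_block_mat ?e ?Z ?Z' A3)" "j < dim_col (four_block_mat ?e ?Z ?Z' A3)"
    then have "i < ?n" "j < ?n" by (auto simp: A3_def)
    then show "A' $$ (i, j) = four_block_mat ?e ?Z ?Z' A3 $$ (i, j)"
      using A'0 A'ij[of 0 j] by (cases i; cases j) (auto simp: A3_def)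
  qed (use A' A3 in auto)
  have B: "B \<in> carrier_mat ?n ?n" using P(1) by (auto simp: B_def)
  have BT: "B\<^sup>T = four_block_mat (1\<^sub>m 1) ?Z ?Z' P\<^sup>T"
    unfolding B_def using P(1)
    by (subst transpose_four_block_mat[of _ 1 1 _ m _ m]) auto
  have PT: "P\<^sup>T \<in> carrier_mat m m" using P by simp
  have BB: "B\<^sup>T * B = 1\<^sub>m ?n"
    unfolding BT unfolding B_def
    using P PT mult_four_block_mat[of "1\<^sub>m 1" 1 1 ?Z m ?Z' m "P\<^sup>T" "1\<^sub>m 1" 1 ?Z m ?Z' P]
    by simp
  have "B\<^sup>T * A' * B = four_block_mat ?e ?Z ?Z' (P\<^sup>T * A3 * P)"
    unfolding BT A'block unfolding B_def
    using P PT A3 mult_four_block_mat[of "1\<^sub>m 1" 1 1 ?Z m ?Z' m "P\<^sup>T" ?e 1 ?Z m ?Z' A3]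
      mult_four_block_mat[of ?e 1 1 ?Z m ?Z' m "P\<^sup>T * A3" "1\<^sub>m 1" 1 ?Z m ?Z' P]
    by simp
  also have "\<dots> = mat_diag ?n (case_nat e f)"
    unfolding P(3) by (rule eq_matI) (auto simp: mat_diag_def split: nat.splits)
  finally have D: "B\<^sup>T * A' * B = mat_diag ?n (case_nat e f)" .
  have tWB: "(W * B)\<^sup>T = B\<^sup>T * W\<^sup>T" using W B by (simp add: transpose_mult)
  have "(W * B)\<^sup>T * (W * B) = B\<^sup>T * (W\<^sup>T * W) * B"
    unfolding tWB using W(1) WT B by (simp add: assoc_mult_mat[of _ ?n ?n _ ?n _ ?n])
  then have "(W * B)\<^sup>T * (W * B) = 1\<^sub>m ?n" using W(2) B BB by simp
  moreover have "(W * B)\<^sup>T * A * (W * B) = B\<^sup>T * A' * B"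
    unfolding tWB A'_def using W(1) WT B A by (simp add: assoc_mult_mat[of _ ?n ?n _ ?n _ ?n])
  ultimately show ?case using D W(1) B by (metis mult_carrier_mat)
qed

section \<open>Counting positive eigenvalues\<close>

lemma order_prod_linear_factors:
  "order x (\<Prod>a\<leftarrow>as. [:- a, 1:]) = count_list as (x :: 'a :: idom)"
proof (induction as)
  case (Cons a as)
  have nz: "(\<Prod>a\<leftarrow>bs. [:- a, 1 :: 'a:]) \<noteq> 0" for bs
    by (induction bs) (simp_all del: mult_pCons_left)
  have "[:- a, 1:] * (\<Prod>a\<leftarrow>as. [:- a, 1:]) \<noteq> 0"
    using nz[of "a # as"] by (simp del: mult_pCons_left)
  moreover have "order x [:- a, 1:] = (if a = x then 1 else 0)"
    using order_power_n_n[of x 1] by (auto intro: order_0I)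
  ultimately show ?case using Cons by (simp add: order_mult del: mult_pCons_left)
qed (simp add: order_0I)

text \<open>
  Diagonalising turns algebraic multiplicity into the number of occurrences on the diagonal: both
  matrices have the same characteristic polynomial, and for the diagonal one it splits into the
  linear factors given by the entries.
\<close>

lemma num_pos_eigenvalues_eq_card:
  fixes A :: "real mat"
  assumes A: "A \<in> carrier_mat n n" and P: "P \<in> carrier_mat n n" "P\<^sup>T * P = 1\<^sub>m n"
    and diag: "P\<^sup>T * A * P = mat_diag n f"
  shows "num_pos_eigenvalues A = card {i. i < n \<and> f i > 0}"
proof -
  have PT: "P\<^sup>T \<in> carrier_mat n n" using P by simp
  have PPT: "P * P\<^sup>T = 1\<^sub>m n" using mat_mult_left_right_inverse[OF PT P] .
  have "similar_mat (mat_diag n f) A"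
    unfolding similar_mat_def
    by (intro exI[of _ "P\<^sup>T"] exI[of _ P] similar_mat_witI[of _ _ n])
       (use A P PT PPT diag in auto)
  then have "char_poly A = char_poly (mat_diag n f)" by (simp add: char_poly_similar)
  also have "\<dots> = (\<Prod>a\<leftarrow>diag_mat (mat_diag n f). [:- a, 1:])"
    by (rule char_poly_upper_triangular[of _ n]) (auto simp: mat_diag_def)
  also have "diag_mat (mat_diag n f) = map f [0..<n]"
    by (auto simp: diag_mat_def mat_diag_def)
  finally have cp: "char_poly A = (\<Prod>a\<leftarrow>map f [0..<n]. [:- a, 1:])" .
  have order: "order x (char_poly A) = card {i. i < n \<and> f i = x}" for x
    unfolding cp order_prod_linear_factors
    by (auto simp: count_list_eq_length_filter length_filter_conv_card intro!: arg_cong[of _ _ card])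
  have ev: "eigenvalue A x \<longleftrightarrow> x \<in> f ` {..<n}" for x
    unfolding eigenvalue_root_char_poly[OF A] cp poly_prod_list prod_list_zero_iff by auto
  let ?I = "{i. i < n \<and> f i > 0}"
  have "card ?I = (\<Sum>x\<in>f ` ?I. \<Sum>i | i \<in> ?I \<and> f i = x. 1)"
    by (subst card_eq_sum, rule sum.image_gen) simp
  also have "\<dots> = (\<Sum>x\<in>f ` ?I. order x (char_poly A))"
    unfolding order by (intro sum.cong) (auto intro!: arg_cong[of _ _ card])
  also have "f ` ?I = {x. eigenvalue A x \<and> x > 0}" by (auto simp: ev)
  finally show ?thesis by (simp add: num_pos_eigenvalues_def)
qed

text \<open>
  Padding the coefficient matrix with zero rows makes it square and singular.
\<close>

lemma underdetermined_system_nonzero_solution: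
  fixes C :: "'a :: field mat"
  assumes C: "C \<in> carrier_mat m k" and mk: "m < k"
  shows "\<exists>c\<in>carrier_vec k. c \<noteq> 0\<^sub>v k \<and> C *\<^sub>v c = 0\<^sub>v m"
proof -
  define D where "D = mat k k (\<lambda>(i, j). if i < m then C $$ (i, j) else 0)"
  have D: "D \<in> carrier_mat k k" by (simp add: D_def)
  have "det D = 0"
    unfolding det_def'[OF D]
  proof (intro sum.neutral ballI)
    fix p assume "p \<in> {p. p permutes {0..<k}}"
    then have "p m < k" using mk permutes_in_image[of p "{0..<k}" m] by simp
    then have "(\<Prod>i = 0..<k. D $$ (i, p i)) = 0"
      using mk by (intro prod_zero bexI[of _ m]) (auto simp: D_def)
    then show "signof p * (\<Prod>i = 0..<k. D $$ (i, p i)) = 0" by simp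
  qed
  then obtain c where c: "c \<in> carrier_vec k" "c \<noteq> 0\<^sub>v k" "D *\<^sub>v c = 0\<^sub>v k"
    using det_0_iff_vec_prod_zero_field[OF D] by blast
  have "C *\<^sub>v c = 0\<^sub>v m"
  proof (rule eq_vecI)
    fix i assume "i < dim_vec (0\<^sub>v m :: 'a vec)"
    then have i: "i < m" by simp
    have "row C i = row D i" using i mk C by (intro eq_vecI) (auto simp: D_def)
    then have "(C *\<^sub>v c) $ i = (D *\<^sub>v c) $ i" using i mk C D by simp
    then show "(C *\<^sub>v c) $ i = 0\<^sub>v m $ i" using c(3) i mk by simp
  qed (use C in simp)
  then show ?thesis using c by blast
qed

text \<open>
  The half of the Courant--Fischer principle that bounds the number of positive eigenvalues from
  below: a form that is positive on the image under \<open>X\<close> of the solution space of \<open>r\<close> linear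
  equations in \<open>k\<close> unknowns has at least \<open>k - r\<close> of them. Otherwise one could impose, besides
  the \<open>r\<close> equations, that the coordinate along every eigenvector of a positive eigenvalue
  vanishes, and still find a nonzero \<open>c\<close>; at \<open>X c\<close> the form would then be a sum of
  nonpositive terms. Positivity makes \<open>X\<close> injective on that solution space, so this is a
  statement about subspaces; the parametrisation by \<open>c\<close> spares any discussion of dimensions.
\<close>

lemma num_pos_eigenvalues_ge_dim:
  fixes A :: "real mat"
  assumes A: "A \<in> carrier_mat n n" and sym: "A\<^sup>T = A"
    and X: "X \<in> carrier_mat n k" and U: "U \<in> carrier_mat r k"
    and pos: "\<And>c. c \<in> carrier_vec k \<Longrightarrow> c \<noteq> 0\<^sub>v k \<Longrightarrow> U *\<^sub>v c = 0\<^sub>v r \<Longrightarrow>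
      (X *\<^sub>v c) \<bullet> (A *\<^sub>v (X *\<^sub>v c)) > 0"
  shows "k \<le> num_pos_eigenvalues A + r"
proof (rule ccontr)
  assume contr: "\<not> ?thesis"
  obtain P f where P: "P \<in> carrier_mat n n" "P\<^sup>T * P = 1\<^sub>m n"
    and diag: "P\<^sup>T * A * P = mat_diag n f"
    using real_symmetric_diagonalization[OF A sym] by blast
  have PT: "P\<^sup>T \<in> carrier_mat n n" using P by simp
  have PPT: "P * P\<^sup>T = 1\<^sub>m n" using mat_mult_left_right_inverse[OF PT P] .
  define pos_idx where "pos_idx = filter (\<lambda>i. f i > 0) [0..<n]"
  have "length pos_idx = num_pos_eigenvalues A"
    unfolding num_pos_eigenvalues_eq_card[OF A P diag] pos_idx_def
    by (simp add: length_filter_conv_card cong: conj_cong)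
  with contr have few: "r + length pos_idx < k" by simp
  let ?Y = "P\<^sup>T * X"
  \<comment> \<open>The first rows are the given equations; the others ask the coordinate \<open>(P\<^sup>T X c)\<^sub>i\<close> to
    vanish wherever the diagonal entry is positive.\<close>
  define C where "C = mat (r + length pos_idx) k
    (\<lambda>(i, j). if i < r then U $$ (i, j) else ?Y $$ (pos_idx ! (i - r), j))"
  have C: "C \<in> carrier_mat (r + length pos_idx) k" by (simp add: C_def)
  obtain c where c: "c \<in> carrier_vec k" "c \<noteq> 0\<^sub>v k" "C *\<^sub>v c = 0\<^sub>v (r + length pos_idx)"
    using underdetermined_system_nonzero_solution[OF C few] by blast
  have row_c: "row C i \<bullet> c = 0" if "i < r + length pos_idx" for i
    using arg_cong[OF c(3), of "\<lambda>v. v $ i"] C that by simp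
  have Uc: "U *\<^sub>v c = 0\<^sub>v r"
  proof (rule eq_vecI)
    fix i assume "i < dim_vec (0\<^sub>v r :: real vec)"
    then have i: "i < r" by simp
    then have "row U i = row C i" using U by (intro eq_vecI) (auto simp: C_def)
    then show "(U *\<^sub>v c) $ i = 0\<^sub>v r $ i" using row_c[of i] i U by simp
  qed (use U in simp)
  define y where "y = ?Y *\<^sub>v c"
  have Y: "?Y \<in> carrier_mat n k" using PT X by simp
  have y: "y \<in> carrier_vec n" unfolding y_def using Y c(1) by (rule mult_mat_vec_carrier)
  have y0: "y $ i = 0" if i: "i < n" "f i > 0" for i
  proof -
    have "i \<in> set pos_idx" using i by (simp add: pos_idx_def)
    then obtain j where j: "j < length pos_idx" "pos_idx ! j = i" by (auto simp: in_set_conv_nth)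
    have "row ?Y i = row C (r + j)" using j i P(1) X by (intro eq_vecI) (auto simp: C_def)
    moreover have "y $ i = row ?Y i \<bullet> c"
      unfolding y_def using i P(1) by (intro index_mult_mat_vec) simp
    ultimately show ?thesis using row_c[of "r + j"] j by simp
  qed
  let ?x = "X *\<^sub>v c"
  have x: "?x \<in> carrier_vec n" using X c by simp
  have yx: "y = P\<^sup>T *\<^sub>v ?x" unfolding y_def using PT X c(1) by (rule assoc_mult_mat_vec)
  have xy: "?x = P *\<^sub>v y"
    using assoc_mult_mat_vec[OF P(1) PT x] x by (simp add: yx PPT)
  have Ax: "A *\<^sub>v ?x \<in> carrier_vec n" using A x by simp
  have "?x \<bullet> (A *\<^sub>v ?x) = (A *\<^sub>v ?x) \<bullet> (P *\<^sub>v y)"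
    using comm_scalar_prod[OF x Ax] xy by simp
  also have "\<dots> = (P\<^sup>T *\<^sub>v (A *\<^sub>v ?x)) \<bullet> y"
    using transpose_vec_mult_scalar[OF P(1) y Ax] by simp
  also have "P\<^sup>T *\<^sub>v (A *\<^sub>v ?x) = mat_diag n f *\<^sub>v y"
  proof -
    have "mat_diag n f *\<^sub>v y = (P\<^sup>T * A) *\<^sub>v (P *\<^sub>v y)"
      unfolding diag[symmetric] using PT A P(1) y by (intro assoc_mult_mat_vec[of _ n n]) auto
    also have "\<dots> = P\<^sup>T *\<^sub>v (A *\<^sub>v ?x)"
      unfolding xy[symmetric] by (rule assoc_mult_mat_vec[OF PT A x])
    finally show ?thesis by simp
  qed
  also have "(mat_diag n f *\<^sub>v y) \<bullet> y = (\<Sum>i<n. f i * (y $ i)\<^sup>2)"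
  proof -
    have "(mat_diag n f *\<^sub>v y) $ i = f i * y $ i" if "i < n" for i
      using that y by (simp add: mat_diag_def scalar_prod_def if_distrib[of "\<lambda>z. z * _"] cong: if_cong)
    then show ?thesis using y
      by (auto simp: scalar_prod_def lessThan_atLeast0 power2_eq_square intro!: sum.cong)
  qed
  also have "\<dots> \<le> 0"
  proof (rule sum_nonpos)
    fix i assume "i \<in> {..<n}"
    then show "f i * (y $ i)\<^sup>2 \<le> 0"
      using y0[of i] by (cases "f i > 0") (auto simp: mult_nonpos_nonneg)
  qed
  finally show False using pos[OF c(1,2) Uc] by simp
qed

section \<open>Diagonal dominance\<close>

text \<open>
  Each product \<open>c i * c j * K i j\<close> is at least \<open>- \<bar>K i j\<bar> * ((c i)\<^sup>2 + (c j)\<^sup>2) / 2\<close>. By symmetry,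
  the coefficient of \<open>(c i)\<^sup>2\<close> thus loses exactly the sum of the absolute values in row \<open>i\<close> off the
  diagonal, which is less than \<open>K i i\<close>.
\<close>

lemma strictly_diagonally_dominant_pos:
  fixes K :: "'a \<Rightarrow> 'a \<Rightarrow> real"
  assumes fin: "finite I" and sym: "\<And>i j. i \<in> I \<Longrightarrow> j \<in> I \<Longrightarrow> K i j = K j i"
    and dom: "\<And>i. i \<in> I \<Longrightarrow> (\<Sum>j\<in>I - {i}. \<bar>K i j\<bar>) < K i i"
    and nz: "l \<in> I" "c l \<noteq> 0"
  shows "(\<Sum>i\<in>I. \<Sum>j\<in>I. c i * c j * K i j) > 0"
proof -
  let ?R = "\<lambda>i. \<Sum>j\<in>I - {i}. \<bar>K i j\<bar>"
  have split: "(\<Sum>j\<in>I. g j) = g i + (\<Sum>j\<in>I - {i}. g j)" if "i \<in> I" for i and g :: "'a \<Rightarrow> real"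
    using fin that by (rule sum.remove)
  have off: "(\<Sum>j\<in>I - {i}. g j) = (\<Sum>j\<in>I. if i = j then 0 else g j)"
    if "i \<in> I" for i and g :: "'a \<Rightarrow> real"
  proof -
    have "(\<Sum>j\<in>I - {i}. g j) = (\<Sum>j\<in>I - {i}. if i = j then 0 else g j)"
      by (rule sum.cong) auto
    then show ?thesis using split[OF that, of "\<lambda>j. if i = j then 0 else g j"] by simp
  qed
  have swap: "(\<Sum>i\<in>I. \<Sum>j\<in>I - {i}. \<bar>K i j\<bar> * (c j)\<^sup>2) = (\<Sum>i\<in>I. (c i)\<^sup>2 * ?R i)"
  proof -
    have "(\<Sum>i\<in>I. \<Sum>j\<in>I - {i}. \<bar>K i j\<bar> * (c j)\<^sup>2) =
        (\<Sum>i\<in>I. \<Sum>j\<in>I. if i = j then 0 else \<bar>K i j\<bar> * (c j)\<^sup>2)"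
      by (intro sum.cong refl off)
    also have "\<dots> = (\<Sum>j\<in>I. \<Sum>i\<in>I. if i = j then 0 else \<bar>K i j\<bar> * (c j)\<^sup>2)"
      by (rule sum.swap)
    also have "\<dots> = (\<Sum>j\<in>I. (c j)\<^sup>2 * ?R j)"
      by (intro sum.cong refl) (auto simp: off sum_distrib_left sym intro!: sum.cong)
    finally show ?thesis .
  qed
  have young: "c i * c j * K i j \<ge> - (\<bar>K i j\<bar> * (c i)\<^sup>2 / 2 + \<bar>K i j\<bar> * (c j)\<^sup>2 / 2)" for i j
  proof -
    have "2 * (\<bar>c i\<bar> * \<bar>c j\<bar>) \<le> (c i)\<^sup>2 + (c j)\<^sup>2"
      using sum_squares_bound[of "\<bar>c i\<bar>" "\<bar>c j\<bar>"] by simp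
    then have "\<bar>c i * c j * K i j\<bar> \<le> \<bar>K i j\<bar> * (((c i)\<^sup>2 + (c j)\<^sup>2) / 2)"
      unfolding abs_mult by (subst mult.commute, intro mult_left_mono) auto
    then show ?thesis by (simp add: algebra_simps add_divide_distrib abs_le_iff)
  qed
  have "0 < (\<Sum>i\<in>I. (c i)\<^sup>2 * (K i i - ?R i))"
    using fin nz dom by (intro sum_pos2[of _ l]) (auto simp: less_imp_le)
  also have "\<dots> = (\<Sum>i\<in>I. (c i)\<^sup>2 * K i i - (c i)\<^sup>2 * ?R i / 2) - (\<Sum>i\<in>I. (c i)\<^sup>2 * ?R i) / 2"
    by (simp add: sum_subtractf[symmetric] sum_divide_distrib right_diff_distrib)
  also have "\<dots> = (\<Sum>i\<in>I. (c i)\<^sup>2 * K i i +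
      (\<Sum>j\<in>I - {i}. - (\<bar>K i j\<bar> * (c i)\<^sup>2 / 2 + \<bar>K i j\<bar> * (c j)\<^sup>2 / 2)))"
    unfolding swap[symmetric]
    by (simp add: sum_subtractf sum.distrib sum_negf sum_divide_distrib sum_distrib_left mult.commute)
  also have "\<dots> \<le> (\<Sum>i\<in>I. (c i)\<^sup>2 * K i i + (\<Sum>j\<in>I - {i}. c i * c j * K i j))"
    by (intro sum_mono add_left_mono young)
  also have "\<dots> = (\<Sum>i\<in>I. \<Sum>j\<in>I. c i * c j * K i j)"
  proof (rule sum.cong)
    fix i assume i: "i \<in> I"
    show "(c i)\<^sup>2 * K i i + (\<Sum>j\<in>I - {i}. c i * c j * K i j) = (\<Sum>j\<in>I. c i * c j * K i j)"
      unfolding split[OF i] by (simp add: power2_eq_square)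
  qed simp
  finally show ?thesis .
qed

section \<open>Edge weights, volumes and the modularity form\<close>

lemma adj_mat_sym: "i < n \<Longrightarrow> j < n \<Longrightarrow> adj_mat n E \<omega> $$ (i, j) = adj_mat n E \<omega> $$ (j, i)"
  by (simp add: adj_mat_def insert_commute)

lemma e_between_commute:
  assumes "S \<subseteq> {..<n}" "T \<subseteq> {..<n}"
  shows "e_between n E \<omega> S T = e_between n E \<omega> T S"
  unfolding e_between_def using assms
  by (subst sum.swap) (auto intro!: sum.cong adj_mat_sym)

lemma vol_eq_e_in_plus_e_out:
  assumes "S \<subseteq> {..<n}"
  shows "vol n E \<omega> S = e_in n E \<omega> S + e_out n E \<omega> S"
proof -
  have "(\<Sum>j<n. adj_mat n E \<omega> $$ (i, j)) =
      (\<Sum>j\<in>S. adj_mat n E \<omega> $$ (i, j)) + (\<Sum>j\<in>{..<n} - S. adj_mat n E \<omega> $$ (i, j))" for i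
    using sum.subset_diff[OF assms finite_lessThan] by (simp add: add.commute)
  moreover have "deg_vec n E \<omega> $ i = (\<Sum>j<n. adj_mat n E \<omega> $$ (i, j))" if "i \<in> S" for i
    using that assms by (auto simp: deg_vec_def)
  ultimately show ?thesis
    by (simp add: vol_def e_in_def e_out_def e_between_def sum.distrib)
qed

lemma modularity_mat_carrier: "modularity_mat n E \<omega> \<in> carrier_mat n n"
  unfolding modularity_mat_def by (intro minus_carrier_mat smult_carrier_mat mat_carrier)

lemma modularity_mat_index:
  assumes "i < n" "j < n"
  shows "modularity_mat n E \<omega> $$ (i, j) =
    adj_mat n E \<omega> $$ (i, j) - deg_vec n E \<omega> $ i * deg_vec n E \<omega> $ j / vol n E \<omega> {..<n}"
  using assms by (simp add: modularity_mat_def)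

lemma modularity_mat_sym: "(modularity_mat n E \<omega>)\<^sup>T = modularity_mat n E \<omega>"
proof (rule eq_matI)
  let ?M = "modularity_mat n E \<omega>"
  note dim = carrier_matD[OF modularity_mat_carrier[of n E \<omega>]]
  show "dim_row ?M\<^sup>T = dim_row ?M" "dim_col ?M\<^sup>T = dim_col ?M"
    by (simp_all only: dim index_transpose_mat)
  fix i j assume "i < dim_row ?M" "j < dim_col ?M"
  then have ij: "i < n" "j < n" by (simp_all only: dim)
  then have "?M\<^sup>T $$ (i, j) = ?M $$ (j, i)" by (simp only: index_transpose_mat dim)
  also have "\<dots> = ?M $$ (i, j)"
    using adj_mat_sym[OF ij, of E \<omega>] by (simp only: modularity_mat_index ij mult.commute)
  finally show "?M\<^sup>T $$ (i, j) = ?M $$ (i, j)" .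
qed

text \<open>
  The rank-one correction in the modularity matrix contributes the square of \<open>d \<bullet> x\<close>, so on
  the hyperplane orthogonal to the degree vector the quadratic forms of \<open>M\<close> and of the adjacency
  matrix agree.
\<close>

lemma modularity_quadratic_form_eq:
  assumes x: "x \<in> carrier_vec n"
  shows "x \<bullet> (modularity_mat n E \<omega> *\<^sub>v x) =
    (\<Sum>i<n. (\<Sum>j<n. adj_mat n E \<omega> $$ (i, j) * x $ j) * x $ i) -
    (\<Sum>i<n. deg_vec n E \<omega> $ i * x $ i)\<^sup>2 / vol n E \<omega> {..<n}"
proof -
  let ?A = "adj_mat n E \<omega>" and ?D = "deg_vec n E \<omega>" and ?V = "vol n E \<omega> {..<n}"
  note dim = carrier_matD[OF modularity_mat_carrier[of n E \<omega>]]
  have "x \<bullet> (modularity_mat n E \<omega> *\<^sub>v x) =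
      (\<Sum>i<n. x $ i * (\<Sum>j<n. (?A $$ (i, j) - ?D $ i * ?D $ j / ?V) * x $ j))"
    using x by (auto simp: scalar_prod_def dim modularity_mat_index lessThan_atLeast0 intro!: sum.cong)
  also have "\<dots> = (\<Sum>i<n. (\<Sum>j<n. ?A $$ (i, j) * x $ j) * x $ i) -
      (\<Sum>i<n. \<Sum>j<n. (?D $ i * x $ i) * (?D $ j * x $ j)) / ?V"
    by (simp add: sum_subtractf[symmetric] sum_divide_distrib sum_distrib_left sum_distrib_right
        algebra_simps)
  finally show ?thesis by (simp add: power2_eq_square sum_product)
qed

text \<open>
  Pairing with a linear combination of characteristic vectors. The coefficient vector \<open>c\<close> is kept
  as the argument of a matrix, so that the result applies to the subspace bound above.
\<close>

lemma sum_indicator_combination: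
  fixes g :: "nat \<Rightarrow> real" and c :: "real vec"
  assumes T: "\<And>a. a < k \<Longrightarrow> T a \<subseteq> {..<n}" and c: "c \<in> carrier_vec k"
  shows "(\<Sum>i<n. g i * (mat n k (\<lambda>(i, a). indicator (T a) i) *\<^sub>v c) $ i) =
    (\<Sum>a<k. c $ a * (\<Sum>i\<in>T a. g i))"
proof -
  have "(\<Sum>i<n. g i * (mat n k (\<lambda>(i, a). indicator (T a) i) *\<^sub>v c) $ i) =
      (\<Sum>i<n. \<Sum>a<k. c $ a * (g i * indicator (T a) i))"
    using c by (auto simp: scalar_prod_def lessThan_atLeast0 sum_distrib_left mult_ac intro!: sum.cong)
  also have "\<dots> = (\<Sum>a<k. c $ a * (\<Sum>i<n. g i * indicator (T a) i))"
    by (subst sum.swap) (simp only: sum_distrib_left)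
  also have "\<dots> = (\<Sum>a<k. c $ a * (\<Sum>i\<in>T a. g i))"
    using T by (intro sum.cong refl) (simp add: sum_mult_indicator Int_absorb1)
  finally show ?thesis .
qed

context connected_weighted_graph
begin

lemma adj_mat_nonneg: "i < n \<Longrightarrow> j < n \<Longrightarrow> adj_mat n E \<omega> $$ (i, j) \<ge> 0"
  using weight_pos by (auto simp: adj_mat_def less_imp_le)

lemma e_between_nonneg:
  "S \<subseteq> {..<n} \<Longrightarrow> T \<subseteq> {..<n} \<Longrightarrow> e_between n E \<omega> S T \<ge> 0"
  unfolding e_between_def by (intro sum_nonneg adj_mat_nonneg) auto

text \<open>
  Half of \<open>vol S = e_in + e_out\<close> is less than \<open>e_in\<close>, and \<open>vol S\<close> being at most half of the
  total volume bounds \<open>(vol S)\<^sup>2 / vol G\<close> by \<open>vol S / 2\<close>. The strict inequality between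
  \<open>e_in\<close> and \<open>e_out\<close> also forces both volumes to be positive.
\<close>

lemma modularity_pos:
  assumes S: "S \<subseteq> {..<n}" and half: "vol n E \<omega> S \<le> vol n E \<omega> {..<n} / 2"
    and dom: "e_in n E \<omega> S > e_out n E \<omega> S"
  shows "modularity n E \<omega> S > 0"
proof -
  let ?v = "vol n E \<omega> S" and ?V = "vol n E \<omega> {..<n}"
  have out: "e_out n E \<omega> S \<ge> 0" unfolding e_out_def using S by (intro e_between_nonneg) auto
  have vS: "?v = e_in n E \<omega> S + e_out n E \<omega> S" by (rule vol_eq_e_in_plus_e_out[OF S])
  then have v: "?v > 0" using dom out by linarith
  then have V: "?V > 0" using half by linarith
  have "?v\<^sup>2 / ?V = ?v * (?v / ?V)" by (simp add: power2_eq_square)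
  also have "\<dots> \<le> ?v * (1 / 2)" using half v V by (intro mult_left_mono) (auto simp: field_simps)
  also have "\<dots> < e_in n E \<omega> S" using vS dom by simp
  finally show ?thesis by (simp add: modularity_def)
qed

text \<open>
  Disjoint sets other than \<open>T a\<close> lie in its complement, so the edges towards them are among the
  outgoing ones.
\<close>

lemma sum_e_between_le_e_out:
  assumes I: "finite I" "a \<in> I" and T: "\<And>b. b \<in> I \<Longrightarrow> T b \<subseteq> {..<n}"
    and disj: "disjoint_family_on T I"
  shows "(\<Sum>b\<in>I - {a}. e_between n E \<omega> (T a) (T b)) \<le> e_out n E \<omega> (T a)"
proof -
  let ?A = "adj_mat n E \<omega>"
  have "(\<Sum>b\<in>I - {a}. \<Sum>j\<in>T b. ?A $$ (i, j)) \<le> (\<Sum>j\<in>{..<n} - T a. ?A $$ (i, j))"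
    if i: "i \<in> T a" for i
  proof -
    have fin: "finite (T b)" if "b \<in> I" for b
      using T[OF that] finite_subset by blast
    have "(\<Sum>b\<in>I - {a}. \<Sum>j\<in>T b. ?A $$ (i, j)) = (\<Sum>j\<in>(\<Union>b\<in>I - {a}. T b). ?A $$ (i, j))"
      using I fin disj by (subst sum.UNION_disjoint) (auto simp: disjoint_family_on_def)
    also have "\<dots> \<le> (\<Sum>j\<in>{..<n} - T a. ?A $$ (i, j))"
    proof (rule sum_mono2)
      show "(\<Union>b\<in>I - {a}. T b) \<subseteq> {..<n} - T a"
        using T disj I(2) unfolding disjoint_family_on_def by blast
      fix j assume "j \<in> {..<n} - T a - (\<Union>b\<in>I - {a}. T b)"
      then show "?A $$ (i, j) \<ge> 0" using i T[OF I(2)] by (intro adj_mat_nonneg) auto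
    qed simp
    finally show ?thesis .
  qed
  then have "(\<Sum>i\<in>T a. \<Sum>b\<in>I - {a}. \<Sum>j\<in>T b. ?A $$ (i, j)) \<le> e_out n E \<omega> (T a)"
    unfolding e_out_def e_between_def by (rule sum_mono)
  then show ?thesis unfolding e_between_def by (subst sum.swap)
qed

text \<open>
  On combinations \<open>x\<close> of the characteristic vectors, the form of the adjacency matrix is given by
  the matrix of edge weights between the sets, which is strictly diagonally dominant. The single
  equation \<open>d \<bullet> x = 0\<close> removes the rank-one part of \<open>M\<close>, at the cost of one dimension.
\<close>

lemma num_pos_eigenvalues_modularity_mat_ge:
  assumes T: "\<And>a. a < k \<Longrightarrow> T a \<subseteq> {..<n}" and disj: "disjoint_family_on T {..<k}"
    and dom: "\<And>a. a < k \<Longrightarrow> e_in n E \<omega> (T a) > e_out n E \<omega> (T a)"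
  shows "k \<le> num_pos_eigenvalues (modularity_mat n E \<omega>) + 1"
proof (rule num_pos_eigenvalues_ge_dim)
  let ?A = "adj_mat n E \<omega>" and ?M = "modularity_mat n E \<omega>"
  let ?X = "mat n k (\<lambda>(i, a). indicator (T a) i) :: real mat"
  let ?U = "mat 1 k (\<lambda>(i, a). vol n E \<omega> (T a))"
  show "?M \<in> carrier_mat n n" "?M\<^sup>T = ?M" by (rule modularity_mat_carrier modularity_mat_sym)+
  show "?X \<in> carrier_mat n k" "?U \<in> carrier_mat 1 k" by simp_all
  fix c assume c: "c \<in> carrier_vec k" "c \<noteq> 0\<^sub>v k" "?U *\<^sub>v c = 0\<^sub>v 1"
  let ?x = "?X *\<^sub>v c"
  have x: "?x \<in> carrier_vec n" by (intro mult_mat_vec_carrier[of _ n k] c) simp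
  have comb: "(\<Sum>i<n. g i * ?x $ i) = (\<Sum>a<k. c $ a * (\<Sum>i\<in>T a. g i))" for g
    using T c(1) by (rule sum_indicator_combination)
  have "(\<Sum>i<n. deg_vec n E \<omega> $ i * ?x $ i) = (\<Sum>a<k. c $ a * vol n E \<omega> (T a))"
    unfolding vol_def by (rule comb)
  also have "\<dots> = (?U *\<^sub>v c) $ 0"
    using c(1) by (simp add: scalar_prod_def lessThan_atLeast0 mult.commute)
  finally have orth: "(\<Sum>i<n. deg_vec n E \<omega> $ i * ?x $ i) = 0" unfolding c(3) by simp
  have "(\<Sum>i<n. (\<Sum>j<n. ?A $$ (i, j) * ?x $ j) * ?x $ i) =
      (\<Sum>a<k. c $ a * (\<Sum>i\<in>T a. \<Sum>b<k. c $ b * (\<Sum>j\<in>T b. ?A $$ (i, j))))"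
    by (simp only: comb)
  also have "\<dots> = (\<Sum>a<k. \<Sum>b<k. c $ a * c $ b * e_between n E \<omega> (T a) (T b))"
  proof (intro sum.cong refl)
    fix a
    show "c $ a * (\<Sum>i\<in>T a. \<Sum>b<k. c $ b * (\<Sum>j\<in>T b. ?A $$ (i, j))) =
        (\<Sum>b<k. c $ a * c $ b * e_between n E \<omega> (T a) (T b))"
      unfolding e_between_def
      by (subst sum.swap) (simp add: sum_distrib_left mult.assoc)
  qed
  also have "\<dots> > 0"
  proof -
    obtain l where l: "l < k" "c $ l \<noteq> 0"
      using c(1,2) by (metis carrier_vecD eq_vecI index_zero_vec)
    show ?thesis
    proof (rule strictly_diagonally_dominant_pos)
      fix a assume a: "a \<in> {..<k}"
      have "(\<Sum>b\<in>{..<k} - {a}. \<bar>e_between n E \<omega> (T a) (T b)\<bar>) =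
          (\<Sum>b\<in>{..<k} - {a}. e_between n E \<omega> (T a) (T b))"
        using a T by (intro sum.cong refl abs_of_nonneg e_between_nonneg) auto
      also have "\<dots> \<le> e_out n E \<omega> (T a)"
        using a T disj by (intro sum_e_between_le_e_out) auto
      also have "\<dots> < e_between n E \<omega> (T a) (T a)" using dom a by (simp add: e_in_def)
      finally show "(\<Sum>b\<in>{..<k} - {a}. \<bar>e_between n E \<omega> (T a) (T b)\<bar>) <
        e_between n E \<omega> (T a) (T a)" .
    next
      fix a b assume "a \<in> {..<k}" "b \<in> {..<k}"
      then show "e_between n E \<omega> (T a) (T b) = e_between n E \<omega> (T b) (T a)"
        using T by (intro e_between_commute) auto
    next
      show "finite {..<k}" "l \<in> {..<k}" "c $ l \<noteq> 0" using l by simp_all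
    qed
  qed
  finally show "?x \<bullet> (?M *\<^sub>v ?x) > 0"
    unfolding modularity_quadratic_form_eq[OF x] orth by simp
qed

end

theorem theorem6p1:
  fixes n k :: nat and E :: "nat set set" and \<omega> :: "nat set \<Rightarrow> real" and S :: "nat \<Rightarrow> nat set"
  assumes "connected_weighted_graph n E \<omega>"
    and "k \<ge> 1"
    and "\<And>i. i \<in> {1..k} \<Longrightarrow> S i \<subseteq> {..<n}"
    and "disjoint_family_on S {1..k}"
    and "\<And>i. i \<in> {1..k} \<Longrightarrow> vol n E \<omega> (S i) \<le> vol n E \<omega> {..<n} / 2"
    and "\<And>i. i \<in> {1..k} \<Longrightarrow> e_in n E \<omega> (S i) > e_out n E \<omega> (S i)"
  shows "(\<forall>i\<in>{1..k}. modularity n E \<omega> (S i) > 0) \<and>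
    num_pos_eigenvalues (modularity_mat n E \<omega>) \<ge> k - 1"
proof -
  interpret connected_weighted_graph n E \<omega> by fact
  have "disjoint_family_on (\<lambda>a. S (Suc a)) {..<k}"
    unfolding disjoint_family_on_def
  proof (intro ballI impI)
    fix a b assume "a \<in> {..<k}" "b \<in> {..<k}" "a \<noteq> b"
    then show "S (Suc a) \<inter> S (Suc b) = {}"
      by (intro disjoint_family_onD[OF assms(4)]) auto
  qed
  then have "k \<le> num_pos_eigenvalues (modularity_mat n E \<omega>) + 1"
    by (rule num_pos_eigenvalues_modularity_mat_ge[rotated]) (simp_all add: assms(3,6))
  moreover have "modularity n E \<omega> (S i) > 0" if "i \<in> {1..k}" for i
    by (rule modularity_pos[OF assms(3,5,6)[OF that]])
  ultimately show ?thesis by simp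
qed

end
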